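(* Let $D$ and $D'$ be oriented link diagrams on $\mathbb{R}^2$ and let $p$ be a prime. For any subset $S\subset \mathrm{End}(R_p)$, the quandle coloring quivers $Q^{S}_{R_p}(D)$ and $Q^{S}_{R_p}(D')$ are isomorphic if and only if $|\mathrm{Col}_{R_p}(D)|=|\mathrm{Col}_{R_p}(D')|$.
   Context: A quandle is a set $X$ with a binary operation $\ast$ such that (Q1) $x\ast x=x$ for all $x$; (Q2) for each $y$ the map $x\mapsto x\ast y$ is a bijection of $X$; (Q3) $(x\ast y)\ast z=(x\ast z)\ast(y\ast z)$ for all $x,y,z$. A quandle homomorphism is a map $f$ with $f(x\ast y)=f(x)\ast f(y)$; $\mathrm{End}(X)$ is the set of quandle homomorphisms $X\to X$. The dihedral quandle $R_n$ of order $n$ is $\mathbb{Z}/n\mathbb{Z}$ with $x\ast y=2y-x$. $\mathrm{Arc}(D)$ is the set of arcs of a link diagram $D$ (maximal connected pieces running between under-crossings). An $R_n$-coloring of $D$ is a map $c:\mathrm{Arc}(D)\to R_n$ such that at every crossing with over-arc $x_j$ and under-arcs $x_i,x_k$ one has $c(x_i)\ast c(x_j)=c(x_k)$, i.e. $c(x_k)=2c(x_j)-c(x_i)$ (for $R_n$ this condition is symmetric in $x_i,x_k$). $\mathrm{Col}_{R_n}(D)$ is the (finite) set of $R_n$-colorings of $D$. For a finite quandle $X$ and $S\subset\mathrm{End}(X)$, the quandle coloring quiver $Q^S_X(D)$ is the directed graph whose vertices are the elements of $\mathrm{Col}_X(D)$, with an edge directed from $v$ to $w$ when $w=f\circ v$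 for an element $f\in S$. An isomorphism of such quivers is a bijection $\varphi$ between vertex sets such that $(v,w)$ is an edge if and only if $(\varphi(v),\varphi(w))$ is an edge. *)

theory Defs
  imports "HOL-Analysis.Analysis" "Graph_Theory.Pair_Digraph"
begin

section \<open>Quandles\<close>

record 'a quandle_struct =
  qcarrier :: "'a set"
  qop :: "'a \<Rightarrow> 'a \<Rightarrow> 'a"

definition quandle :: "'a quandle_struct \<Rightarrow> bool" where
  "quandle X \<longleftrightarrow>
     (\<forall>x\<in>qcarrier X. qop X x x = x) \<and>
     (\<forall>y\<in>qcarrier X. bij_betw (\<lambda>x. qop X x y) (qcarrier X) (qcarrier X)) \<and>
     (\<forall>x\<in>qcarrier X. \<forall>y\<in>qcarrier X. \<forall>z\<in>qcarrier X.
        qop X (qop X x y) z = qop X (qop X x z) (qop X y z))"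

text \<open>Maps on a carrier are extensional, so that equal maps are equal terms.\<close>

definition quandle_End :: "'a quandle_struct \<Rightarrow> ('a \<Rightarrow> 'a) set" where
  "quandle_End X =
     {f \<in> qcarrier X \<rightarrow>\<^sub>E qcarrier X.
        \<forall>x\<in>qcarrier X. \<forall>y\<in>qcarrier X. f (qop X x y) = qop X (f x) (f y)}"

text \<open>The ring of integers modulo \<open>n\<close> (\<open>n \<ge> 1\<close>) is represented by the residues
  \<open>0, \<dots>, n - 1\<close>.\<close>

definition dihedral_quandle :: "nat \<Rightarrow> int quandle_struct" where
  "dihedral_quandle n =
     \<lparr>qcarrier = {0..<int n}, qop = (\<lambda>x y. (2 * y - x) mod int n)\<rparr>"

lemma quandle_dihedral_quandle:
  assumes "n > 0"
  shows "quandle (dihedral_quandle n)"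
proof -
  have inv: "(2 * y - (2 * y - x) mod m) mod m = x" if "x \<in> {0..<m}" for x y m :: int
    using that by (subst mod_diff_right_eq) simp
  have bij: "bij_betw (\<lambda>x. (2 * y - x) mod m) {0..<m} {0..<m}" if "m > 0" for y m :: int
  proof -
    have "(\<lambda>x. (2 * y - x) mod m) \<in> {0..<m} \<rightarrow> {0..<m}"
      using that by (intro Pi_I) simp
    then show ?thesis
      by (intro bij_betwI[where g = "\<lambda>x. (2 * y - x) mod m"] inv)
  qed
  have dist: "(2 * z - (2 * y - x) mod m) mod m =
      (2 * ((2 * z - y) mod m) - (2 * z - x) mod m) mod m" for x y z m :: int
  proof -
    have "(2 * ((2 * z - y) mod m) - (2 * z - x) mod m) mod m =
        (2 * (2 * z - y) - (2 * z - x)) mod m"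
      by (rule mod_diff_cong) (rule mod_mult_right_eq, rule mod_mod_trivial)
    moreover have "2 * (2 * z - y) - (2 * z - x) = 2 * z - (2 * y - x)"
      by simp
    ultimately show ?thesis
      by (metis mod_diff_right_eq)
  qed
  have idem: "(2 * x - x) mod m = x" if "x \<in> {0..<m}" for x m :: int
    using that by simp
  have "int n > 0"
    using assms by simp
  then show ?thesis
    unfolding quandle_def dihedral_quandle_def quandle_struct.simps
    by (intro conjI ballI idem bij dist)
qed


section \<open>Oriented link diagrams in the plane\<close>

text \<open>
  A diagram is a generic smooth immersion of finitely many oriented circles into the plane together
  with crossing information. The \<open>i\<close>-th circle is \<open>{i} \<times> sphere 0 1\<close>, oriented
  counterclockwise, and \<open>under\<close> is the set of those points of the circles which lie on the lower
  strand at a crossing. The values of \<open>strand\<close> outside the circles are irrelevant.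
\<close>

record link_diagram =
  ncomps :: nat
  strand :: "nat \<Rightarrow> complex \<Rightarrow> real ^ 2"
  under :: "(nat \<times> complex) set"

definition circles :: "link_diagram \<Rightarrow> (nat \<times> complex) set" where
  "circles D = {..<ncomps D} \<times> sphere 0 1"

definition proj :: "link_diagram \<Rightarrow> nat \<times> complex \<Rightarrow> real ^ 2" where
  "proj D P = strand D (fst P) (snd P)"

definition velocity :: "link_diagram \<Rightarrow> nat \<times> complex \<Rightarrow> real ^ 2" where
  "velocity D P = vector_derivative (\<lambda>t. proj D (fst P, snd P * cis t)) (at 0)"

definition smooth_curve :: "(real \<Rightarrow> 'a::real_normed_vector) \<Rightarrow> bool" where
  "smooth_curve g \<longleftrightarrow>
     (\<forall>k t. ((\<lambda>h s. vector_derivative h (at s)) ^^ k) g differentiable (at t))"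

definition det2 :: "real ^ 2 \<Rightarrow> real ^ 2 \<Rightarrow> real" where
  "det2 v w = v $ 1 * w $ 2 - v $ 2 * w $ 1"

definition double_pair :: "link_diagram \<Rightarrow> nat \<times> complex \<Rightarrow> nat \<times> complex \<Rightarrow> bool" where
  "double_pair D P Q \<longleftrightarrow>
     P \<in> circles D \<and> Q \<in> circles D \<and> P \<noteq> Q \<and> proj D P = proj D Q"

definition is_link_diagram :: "link_diagram \<Rightarrow> bool" where
  "is_link_diagram D \<longleftrightarrow>
     (\<forall>i<ncomps D. smooth_curve (\<lambda>t. strand D i (cis t))) \<and>
     (\<forall>P\<in>circles D. velocity D P \<noteq> 0) \<and>
     finite {P. \<exists>Q. double_pair D P Q} \<and>
     (\<forall>P Q R. double_pair D P Q \<and> double_pair D P R \<longrightarrow> Q = R) \<and>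
     (\<forall>P Q. double_pair D P Q \<longrightarrow> det2 (velocity D P) (velocity D Q) \<noteq> 0) \<and>
     under D \<subseteq> {P. \<exists>Q. double_pair D P Q} \<and>
     (\<forall>P Q. double_pair D P Q \<longrightarrow> (P \<in> under D \<longleftrightarrow> Q \<notin> under D))"

text \<open>
  Arcs are taken in the circles rather than in the plane: there, cutting at the under-crossing
  points leaves the upper strand of each crossing intact.
\<close>

definition Arc :: "link_diagram \<Rightarrow> (nat \<times> complex) set set" where
  "Arc D = components (circles D - under D)"

definition arc_into :: "link_diagram \<Rightarrow> nat \<times> complex \<Rightarrow> (nat \<times> complex) set \<Rightarrow> bool" where
  "arc_into D P a \<longleftrightarrow>
     a \<in> Arc D \<and> (\<forall>\<^sub>F t in at_right 0. (fst P, snd P * cis (- t)) \<in> a)"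

definition arc_out_of :: "link_diagram \<Rightarrow> nat \<times> complex \<Rightarrow> (nat \<times> complex) set \<Rightarrow> bool" where
  "arc_out_of D P a \<longleftrightarrow>
     a \<in> Arc D \<and> (\<forall>\<^sub>F t in at_right 0. (fst P, snd P * cis t) \<in> a)"

text \<open>
  \<open>crossing_arcs D x\<^sub>i x\<^sub>j x\<^sub>k\<close>: at some crossing, \<open>x\<^sub>j\<close> is the over-arc, and \<open>x\<^sub>i\<close>, \<open>x\<^sub>k\<close> are
  the under-arcs on the right and on the left of the oriented over-arc, respectively. The
  determinant is positive iff the lower strand passes from the right to the left of the upper
  strand. For dihedral quandles the coloring condition is symmetric in \<open>x\<^sub>i\<close> and \<open>x\<^sub>k\<close>, so there
  the choice of side does not matter.
\<close>

definition crossing_arcs ::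
  "link_diagram \<Rightarrow> (nat \<times> complex) set \<Rightarrow> (nat \<times> complex) set \<Rightarrow> (nat \<times> complex) set \<Rightarrow> bool"
where
  "crossing_arcs D xi xj xk \<longleftrightarrow>
     (\<exists>P Q. double_pair D P Q \<and> P \<in> under D \<and> xj \<in> Arc D \<and> Q \<in> xj \<and>
        (if det2 (velocity D Q) (velocity D P) > 0
         then arc_into D P xi \<and> arc_out_of D P xk
         else arc_out_of D P xi \<and> arc_into D P xk))"


section \<open>Colorings and quandle coloring quivers\<close>

definition Col :: "'a quandle_struct \<Rightarrow> link_diagram \<Rightarrow> ((nat \<times> complex) set \<Rightarrow> 'a) set" where
  "Col X D =
     {c \<in> Arc D \<rightarrow>\<^sub>E qcarrier X.
        \<forall>xi xj xk. crossing_arcs D xi xj xk \<longrightarrow> qop X (c xi) (c xj) = c xk}"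

definition coloring_quiver ::
  "'a quandle_struct \<Rightarrow> ('a \<Rightarrow> 'a) set \<Rightarrow> link_diagram \<Rightarrow>
   ((nat \<times> complex) set \<Rightarrow> 'a) pair_pre_digraph"
where
  "coloring_quiver X S D =
     \<lparr>pverts = Col X D,
      parcs = {(v, w). v \<in> Col X D \<and> w \<in> Col X D \<and> (\<exists>f\<in>S. w = compose (Arc D) f v)}\<rparr>"

definition quiver_isomorphic :: "'v pair_pre_digraph \<Rightarrow> 'w pair_pre_digraph \<Rightarrow> bool" where
  "quiver_isomorphic G H \<longleftrightarrow>
     (\<exists>\<phi>. bij_betw \<phi> (pverts G) (pverts H) \<and>
        (\<forall>v\<in>pverts G. \<forall>w\<in>pverts G. (v, w) \<in> parcs G \<longleftrightarrow> (\<phi> v, \<phi> w) \<in> parcs H))"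

end

theory Submission
  imports Defs "HOL-Number_Theory.Cong"
begin

text \<open>
  An isomorphism of quivers is a bijection of vertices, so only the converse needs an argument. It
  rests on one property of \<open>R\<^sub>p\<close>, that its endomorphisms are rigid: two that agree at two distinct
  points are equal. Indeed, if \<open>f\<close> and
  \<open>g\<close> agree at \<open>x\<close> and \<open>y\<close>, then they agree at \<open>2 y - x\<close>, hence at every \<open>x + k (y - x)\<close>, and these
  are all residues as \<open>p\<close> is prime (\<open>dihedral_End_rigid\<close>).

  Let \<open>X\<close> be any finite quandle with this property and at least two elements. Comparison with a
  constant map shows that an endomorphism which is not injective is constant (\<open>End_cases\<close>). The
  colorings therefore split into the constant ones, one for each element of \<open>X\<close>, and the nonconstant
  ones, on which the automorphism group acts by composition. A nonconstant coloring takes two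
  distinct values, so rigidity makes this action free, and the number of its orbits is determined by
  the number of colorings. If two diagrams have equally many colorings, match the orbits, choose a
  representative in each orbit, extend equivariantly, and send each constant coloring to the
  constant coloring of the same value. The resulting bijection commutes with composition by every
  endomorphism (\<open>equivariant_bijection_Arc_nonempty\<close>), so it is an isomorphism of quivers for all
  \<open>S\<close> simultaneously.

  This count requires finitely many colorings, which rests on the fact that removing finitely many
  points from finitely many circles leaves finitely many components (\<open>finite_Arc\<close>). A diagram
  without arcs is exceptional, since its constant colorings all coincide; it has exactly one
  coloring, whereas every other diagram has at least two.
\<close>

section \<open>Finiteness of the set of arcs\<close>

text \<open>
  Each nonempty member of the cover lies in a single component, and every component meets, hence
  contains, such a member.
\<close>

lemma finite_components_Union_connected:
  assumes "finite F" and conn: "\<And>C. C \<in> F \<Longrightarrow> connected C"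
  shows "finite (components (\<Union>F))"
proof -
  define K where "K C = connected_component_set (\<Union>F) (SOME x. x \<in> C)" for C
  have "components (\<Union>F) \<subseteq> K ` F"
  proof
    fix A assume "A \<in> components (\<Union>F)"
    then obtain x C where x: "A = connected_component_set (\<Union>F) x" "x \<in> C" "C \<in> F"
      by (auto simp: components_def)
    then have "(SOME y. y \<in> C) \<in> C"
      by (metis someI)
    with x conn[of C] have "connected_component (\<Union>F) x (SOME y. y \<in> C)"
      unfolding connected_component_def by blast
    then have "A = K C"
      unfolding K_def x(1) by (intro connected_component_eq[symmetric]) simp
    with x show "A \<in> K ` F"
      by blast
  qed
  with \<open>finite F\<close> show ?thesis
    by (meson finite_imageI finite_subset)
qed

text \<open>
  On the \<open>i\<close>-th circle, cut open to \<open>{0..<2 * pi}\<close>, let \<open>F i\<close> be the finite set of removed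
  parameters. Remaining parameters are grouped by the set of removed parameters below them: between
  two parameters with the same set there is no removed one, so each group is an interval. There is
  at most one group for each subset of \<open>F i\<close>, so these groups form a finite connected cover. An arc
  through the parameter 0 is split in two, so the cover only bounds the number of arcs from above.
\<close>

lemma finite_Arc:
  assumes "finite (under D)"
  shows "finite (Arc D)"
proof -
  define F where "F i = {t \<in> {0..<2 * pi}. (i, cis t) \<in> under D}" for i
  define I where "I i L = {t \<in> {0..<2 * pi} - F i. {x \<in> F i. x < t} = L}" for i L
  define piece where "piece i L = (\<lambda>t. (i, cis t)) ` I i L" for i L
  have Arg2pi_cis: "Arg2pi (cis t) = t" if "t \<in> {0..<2 * pi}" for t
    using that by (intro Arg2pi_unique[of 1]) (auto simp: cis_conv_exp)
  have fin_F: "finite (F i)" for i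
  proof -
    have "F i \<subseteq> (Arg2pi \<circ> snd) ` under D"
      unfolding F_def using Arg2pi_cis by force
    with assms show ?thesis
      by (meson finite_imageI finite_subset)
  qed
  have conn: "connected (piece i L)" for i L
  proof -
    have "is_interval (I i L)"
      unfolding is_interval_1 I_def
    proof (intro ballI allI impI, elim CollectE DiffE conjE, intro CollectI conjI DiffI)
      fix a b t
      assume ab: "a \<in> {0..<2 * pi}" "b \<in> {0..<2 * pi}" "a \<notin> F i" "b \<notin> F i" "a \<le> t" "t \<le> b"
        and L: "{x \<in> F i. x < a} = L" "{x \<in> F i. x < b} = L"
      have *: "x < a" if "x \<in> F i" "x \<le> t" for x
        using that ab L by (smt (verit, best) mem_Collect_eq)
      show "t \<in> {0..<2 * pi}"
        using ab by auto
      show "t \<notin> F i"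
        using *[of t] ab by auto
      show "{x \<in> F i. x < t} = L"
        unfolding L(1)[symmetric] using * ab by force
    qed
    then have "connected (I i L)"
      by (simp add: is_interval_connected)
    then show ?thesis
      unfolding piece_def by (intro connected_continuous_image continuous_intros)
  qed
  have "circles D - under D = \<Union>((\<lambda>(i, L). piece i L) ` (SIGMA i:{..<ncomps D}. Pow (F i)))"
    (is "_ = ?U")
  proof
    show "circles D - under D \<subseteq> ?U"
    proof
      fix P assume P: "P \<in> circles D - under D"
      obtain i z where iz: "P = (i, z)" by force
      define t where "t = Arg2pi z"
      have z: "z = cis t" "t \<in> {0..<2 * pi}"
        using P Arg2pi_eq[of z] Arg2pi[of z] by (auto simp: iz circles_def t_def cis_conv_exp)
      then have "t \<in> I i {x \<in> F i. x < t}"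
        using P by (auto simp: I_def F_def iz)
      then have "P \<in> piece i {x \<in> F i. x < t}"
        by (auto simp: piece_def iz z)
      moreover have "i < ncomps D"
        using P by (auto simp: iz circles_def)
      ultimately show "P \<in> ?U"
        by (intro UN_I[of "(i, {x \<in> F i. x < t})"]) auto
    qed
    show "?U \<subseteq> circles D - under D"
      by (auto simp: piece_def I_def F_def circles_def)
  qed
  moreover have "finite (components ?U)"
    using fin_F conn by (intro finite_components_Union_connected) auto
  ultimately show ?thesis
    by (simp add: Arc_def)
qed

section \<open>Free actions and transversals\<close>

text \<open>
  A free action makes every orbit a copy of \<open>G\<close>. The group axioms enter only through the
  requirement that lying in the same orbit is an equivalence relation on \<open>N\<close>.
\<close>

lemma free_action_transversal:
  fixes act :: "'g \<Rightarrow> 'v \<Rightarrow> 'v"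
  assumes eq: "equiv N {(v, w). v \<in> N \<and> (\<exists>g\<in>G. w = act g v)}"
    and free: "\<And>v g h. \<lbrakk>v \<in> N; g \<in> G; h \<in> G; act g v = act h v\<rbrakk> \<Longrightarrow> g = h"
  obtains T where "T \<subseteq> N" "bij_betw (\<lambda>(g, t). act g t) (G \<times> T) N"
proof -
  define R where "R = {(v, w). v \<in> N \<and> (\<exists>g\<in>G. w = act g v)}"
  have eqR: "equiv N R"
    using eq by (simp add: R_def)
  define rep where "rep C = (SOME v. v \<in> C)" for C :: "'v set"
  define T where "T = rep ` (N // R)"
  have rep: "rep C \<in> C" if "C \<in> N // R" for C
    unfolding rep_def using in_quotient_imp_non_empty[OF eqR that] by (simp add: some_in_eq)
  have T: "T \<subseteq> N"
    using rep in_quotient_imp_subset[OF eqR] by (auto simp: T_def)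
  have same: "s = t" if "s \<in> T" "t \<in> T" "(s, t) \<in> R" for s t
  proof -
    from that obtain C C' where C: "C \<in> N // R" "s = rep C" "C' \<in> N // R" "t = rep C'"
      by (auto simp: T_def)
    then have "C = C'"
      using rep that(3) by (intro quotient_eqI[OF eqR, of C C' s t]) auto
    with C show ?thesis
      by simp
  qed
  have act: "(t, act g t) \<in> R" if "t \<in> N" "g \<in> G" for g t
    using that by (auto simp: R_def)
  have "bij_betw (\<lambda>(g, t). act g t) (G \<times> T) N"
    unfolding bij_betw_def
  proof
    show "inj_on (\<lambda>(g, t). act g t) (G \<times> T)"
    proof (rule inj_onI, clarify)
      fix g s h t
      assume gh: "g \<in> G" "h \<in> G" "s \<in> T" "t \<in> T" "act g s = act h t"
      then have "(s, act g s) \<in> R" "(t, act g s) \<in> R"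
        using act[of s g] act[of t h] T by auto
      then have "(s, t) \<in> R"
        using eqR by (meson equivE symE transE)
      with gh have "s = t"
        by (intro same)
      with gh T free show "g = h \<and> s = t"
        by (metis subsetD)
    qed
    show "(\<lambda>(g, t). act g t) ` (G \<times> T) = N"
    proof
      show "(\<lambda>(g, t). act g t) ` (G \<times> T) \<subseteq> N"
        using act T equiv_type[OF eqR] by fastforce
      show "N \<subseteq> (\<lambda>(g, t). act g t) ` (G \<times> T)"
      proof
        fix v assume v: "v \<in> N"
        then have C: "R `` {v} \<in> N // R"
          by (rule quotientI)
        then have "(rep (R `` {v}), v) \<in> R"
          using rep[OF C] eqR by (meson Image_singleton_iff equivE symE)
        then obtain g where "g \<in> G" "v = act g (rep (R `` {v}))"
          by (auto simp: R_def)
        with C show "v \<in> (\<lambda>(g, t). act g t) ` (G \<times> T)"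
          by (force simp: T_def)
      qed
    qed
  qed
  with T that show thesis
    by blast
qed

section \<open>Endomorphisms and colorings of rigid quandles\<close>

text \<open>
  The arguments below apply to every finite quandle whose endomorphisms are determined by their
  values at any two distinct points. Two elements are required so that a diagram without arcs, which
  has one coloring, can be told apart from the others by counting colorings.
\<close>

locale rigid_quandle =
  fixes X :: "'a quandle_struct"
  assumes quandle: "quandle X"
    and finite_carrier: "finite (qcarrier X)"
    and nontrivial: "card (qcarrier X) \<ge> 2"
    and rigid: "\<lbrakk>f \<in> quandle_End X; g \<in> quandle_End X; x \<in> qcarrier X; y \<in> qcarrier X; x \<noteq> y;
                 f x = g x; f y = g y\<rbrakk> \<Longrightarrow> f = g"
begin

abbreviation "Q \<equiv> qcarrier X"

lemma qop_idem: "x \<in> Q \<Longrightarrow> qop X x x = x"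
  using quandle by (simp add: quandle_def)

lemma qop_closed: "x \<in> Q \<Longrightarrow> y \<in> Q \<Longrightarrow> qop X x y \<in> Q"
  using quandle by (auto simp: quandle_def bij_betw_def)

definition Aut :: "('a \<Rightarrow> 'a) set" where
  "Aut = {f \<in> quandle_End X. bij_betw f Q Q}"

lemma End_mem: "f \<in> quandle_End X \<Longrightarrow> x \<in> Q \<Longrightarrow> f x \<in> Q"
  by (auto simp: quandle_End_def)

lemma End_hom:
  "f \<in> quandle_End X \<Longrightarrow> x \<in> Q \<Longrightarrow> y \<in> Q \<Longrightarrow> f (qop X x y) = qop X (f x) (f y)"
  by (simp add: quandle_End_def)

lemma finite_Aut: "finite Aut"
proof (rule finite_subset)
  show "Aut \<subseteq> Q \<rightarrow>\<^sub>E Q"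
    by (auto simp: Aut_def quandle_End_def)
qed (intro finite_PiE finite_carrier)

lemma const_End: "c \<in> Q \<Longrightarrow> (\<lambda>x\<in>Q. c) \<in> quandle_End X"
  by (auto simp: quandle_End_def qop_idem qop_closed)

lemma compose_End:
  "f \<in> quandle_End X \<Longrightarrow> g \<in> quandle_End X \<Longrightarrow> compose Q g f \<in> quandle_End X"
  by (simp add: quandle_End_def PiE_iff Pi_iff compose_def qop_closed)

lemma id_Aut: "(\<lambda>x\<in>Q. x) \<in> Aut"
  by (auto simp: Aut_def quandle_End_def qop_closed bij_betw_def inj_on_def)

lemma compose_Aut: "f \<in> Aut \<Longrightarrow> g \<in> Aut \<Longrightarrow> compose Q g f \<in> Aut"
  unfolding Aut_def using bij_betw_compose[of f Q Q g Q] compose_End by blast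

text \<open>
  The inverse map is again a homomorphism. It is stated as a left inverse for \<open>compose\<close>, the form
  in which it undoes the action on colorings.
\<close>

lemma inverse_Aut:
  assumes "f \<in> Aut"
  obtains g where "g \<in> Aut" "compose Q g f = (\<lambda>x\<in>Q. x)"
proof
  have f: "f \<in> quandle_End X" "bij_betw f Q Q"
    using assms by (auto simp: Aut_def)
  define g where "g = restrict (inv_into Q f) Q"
  have g: "bij_betw g Q Q"
    using bij_betw_inv_into[OF f(2)] by (simp add: g_def cong: bij_betw_cong)
  then have g_mem: "g x \<in> Q" if "x \<in> Q" for x
    using that by (auto simp: bij_betw_def)
  have fg: "f (g x) = x" if "x \<in> Q" for x
    using that f(2) by (simp add: g_def bij_betw_inv_into_right)
  have gf: "g (f x) = x" if "x \<in> Q" for x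
    using that f by (simp add: g_def bij_betw_inv_into_left End_mem)
  have "g (qop X x y) = qop X (g x) (g y)" if "x \<in> Q" "y \<in> Q" for x y
    using that gf[of "qop X (g x) (g y)"] by (simp add: End_hom[OF f(1)] g_mem fg qop_closed)
  then show "g \<in> Aut"
    using g g_mem by (auto simp: Aut_def quandle_End_def g_def)
  show "compose Q g f = (\<lambda>x\<in>Q. x)"
    by (auto simp: compose_def gf)
qed

text \<open>
  If \<open>f\<close> takes the same value \<open>c\<close> at two points, then it agrees there with the constant map at \<open>c\<close>,
  which is an endomorphism by idempotence; rigidity then gives equality. An injective endomorphism
  is an automorphism because the carrier is finite.
\<close>

lemma End_cases:
  assumes f: "f \<in> quandle_End X"
  obtains "f \<in> Aut" | c where "c \<in> Q" "f = (\<lambda>x\<in>Q. c)"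
proof (cases "inj_on f Q")
  case True
  then have "bij_betw f Q Q"
    using endo_inj_surj[OF finite_carrier _ True] End_mem[OF f] by (auto simp: bij_betw_def)
  with f that show ?thesis
    by (auto simp: Aut_def)
next
  case False
  then obtain x y where xy: "x \<in> Q" "y \<in> Q" "x \<noteq> y" "f x = f y"
    by (auto simp: inj_on_def)
  then have "f = (\<lambda>z\<in>Q. f x)"
    by (intro rigid[OF f const_End]) (auto simp: End_mem f)
  with that xy End_mem[OF f] show ?thesis
    by blast
qed

lemma Col_mem: "v \<in> Col X D \<Longrightarrow> v \<in> Arc D \<rightarrow> Q"
  by (auto simp: Col_def)

lemma Col_ext: "v \<in> Col X D \<Longrightarrow> a \<notin> Arc D \<Longrightarrow> v a = undefined"
  by (auto simp: Col_def)

lemma crossing_arcs_in_Arc: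
  "crossing_arcs D xi xj xk \<Longrightarrow> xi \<in> Arc D \<and> xj \<in> Arc D \<and> xk \<in> Arc D"
  by (auto simp: crossing_arcs_def arc_into_def arc_out_of_def split: if_splits)

lemma compose_Col:
  assumes "f \<in> quandle_End X" "v \<in> Col X D"
  shows "compose (Arc D) f v \<in> Col X D"
proof -
  have v: "v a \<in> Q" if "a \<in> Arc D" for a
    using that Col_mem[OF assms(2)] by blast
  have "qop X (f (v xi)) (f (v xj)) = f (v xk)" if "crossing_arcs D xi xj xk" for xi xj xk
    using that assms crossing_arcs_in_Arc[OF that] v
    by (simp add: End_hom[OF assms(1), symmetric] Col_def)
  then show ?thesis
    using v crossing_arcs_in_Arc[of D] End_mem[OF assms(1)] by (auto simp: Col_def compose_def)
qed

lemma const_Col: "c \<in> Q \<Longrightarrow> (\<lambda>a\<in>Arc D. c) \<in> Col X D"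
  by (auto simp: Col_def qop_idem dest!: crossing_arcs_in_Arc)

definition Const :: "link_diagram \<Rightarrow> ((nat \<times> complex) set \<Rightarrow> 'a) set" where
  "Const D = (\<lambda>c. \<lambda>a\<in>Arc D. c) ` Q"

lemma compose_assoc_Col:
  "v \<in> Col X D \<Longrightarrow>
    compose (Arc D) g (compose (Arc D) f v) = compose (Arc D) (compose Q g f) v"
  using compose_assoc[where f = v and A = "Arc D" and B = Q] Col_mem by metis

lemma compose_id_Col: "v \<in> Col X D \<Longrightarrow> compose (Arc D) (\<lambda>x\<in>Q. x) v = v"
  using Col_mem[of v D] Col_ext[of v D] by (auto simp: compose_def fun_eq_iff)

lemma compose_const_Col:
  "v \<in> Col X D \<Longrightarrow> compose (Arc D) (\<lambda>x\<in>Q. c) v = (\<lambda>a\<in>Arc D. c)"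
  using Col_mem[of v D] by (auto simp: compose_def fun_eq_iff)

lemma compose_Const: "c \<in> Q \<Longrightarrow> compose (Arc D) f (\<lambda>a\<in>Arc D. c) = (\<lambda>a\<in>Arc D. f c)"
  by (auto simp: compose_def)

lemma inj_const: "Arc D \<noteq> {} \<Longrightarrow> inj_on (\<lambda>c. \<lambda>a\<in>Arc D. c) Q"
proof (rule inj_onI)
  fix c d assume "Arc D \<noteq> {}" and eq: "(\<lambda>a\<in>Arc D. c) = (\<lambda>a\<in>Arc D. d)"
  then obtain a where "a \<in> Arc D"
    by blast
  with fun_cong[OF eq, of a] show "c = d"
    by simp
qed

lemma nonconstant_two_values:
  assumes "v \<in> Col X D - Const D" "Arc D \<noteq> {}"
  obtains a b where "a \<in> Arc D" "b \<in> Arc D" "v a \<noteq> v b"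
proof (rule ccontr)
  note two = that
  assume *: "\<not> thesis"
  obtain a where a: "a \<in> Arc D"
    using assms by blast
  have "v a = v b" if "b \<in> Arc D" for b
    using * two a that by blast
  then have "v = (\<lambda>b\<in>Arc D. v a)"
    using assms(1) Col_ext[of v D] by (auto simp: fun_eq_iff restrict_def)
  moreover have "v a \<in> Q"
    using assms a by (auto simp: Col_def)
  ultimately show False
    using assms by (auto simp: Const_def)
qed

text \<open>
  If composition with \<open>f\<close> made \<open>v\<close> constant, composition with the inverse of \<open>f\<close> would show that
  \<open>v\<close> is constant.
\<close>

lemma compose_nonconstant:
  assumes v: "v \<in> Col X D - Const D" and f: "f \<in> Aut"
  shows "compose (Arc D) f v \<in> Col X D - Const D"
proof
  show "compose (Arc D) f v \<in> Col X D"
    using assms by (auto simp: Aut_def compose_Col)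
  show "compose (Arc D) f v \<notin> Const D"
  proof
    assume "compose (Arc D) f v \<in> Const D"
    then obtain c where c: "c \<in> Q" "compose (Arc D) f v = (\<lambda>a\<in>Arc D. c)"
      by (auto simp: Const_def)
    obtain g where g: "g \<in> Aut" "compose Q g f = (\<lambda>x\<in>Q. x)"
      using inverse_Aut[OF f] .
    have "v = compose (Arc D) g (compose (Arc D) f v)"
      using v g by (simp add: compose_assoc_Col compose_id_Col)
    also have "\<dots> = (\<lambda>a\<in>Arc D. g c)"
      using c by (simp add: compose_Const)
    finally have "v \<in> Const D"
      using g c unfolding Const_def Aut_def by (auto intro!: End_mem)
    with v show False
      by blast
  qed
qed

text \<open>
  Automorphisms act freely on nonconstant colorings: if \<open>f \<circ> v = g \<circ> v\<close>, then \<open>f\<close> and \<open>g\<close> agree at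
  two distinct values of \<open>v\<close>, so that \<open>f = g\<close> by rigidity.
\<close>

lemma nonconstant_transversal:
  assumes "Arc D \<noteq> {}"
  obtains T where "T \<subseteq> Col X D - Const D"
    "bij_betw (\<lambda>(f, t). compose (Arc D) f t) (Aut \<times> T) (Col X D - Const D)"
proof (rule free_action_transversal[of "Col X D - Const D" Aut "compose (Arc D)"])
  let ?N = "Col X D - Const D"
  let ?R = "{(v, w). v \<in> ?N \<and> (\<exists>g\<in>Aut. w = compose (Arc D) g v)}"
  show "equiv ?N ?R"
  proof (rule equivI)
    show "?R \<subseteq> ?N \<times> ?N"
      using compose_nonconstant by blast
    show "refl_on ?N ?R"
      using id_Aut compose_id_Col[symmetric] by (auto simp: refl_on_def)
    show "sym ?R"
    proof (rule symI, clarify)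
      fix v f assume v: "v \<in> Col X D" "v \<notin> Const D" and f: "f \<in> Aut"
      obtain g where g: "g \<in> Aut" "compose Q g f = (\<lambda>x\<in>Q. x)"
        using inverse_Aut[OF f] .
      then have "v = compose (Arc D) g (compose (Arc D) f v)"
        using v by (simp add: compose_assoc_Col compose_id_Col)
      with g v f compose_nonconstant[of v D f]
      show "compose (Arc D) f v \<in> ?N \<and> (\<exists>g\<in>Aut. v = compose (Arc D) g (compose (Arc D) f v))"
        by blast
    qed
    show "trans ?R"
      by (rule transI) (auto simp: compose_assoc_Col intro: compose_Aut)
  qed
next
  fix v f g
  assume v: "v \<in> Col X D - Const D" and fg: "f \<in> Aut" "g \<in> Aut"
    and eq: "compose (Arc D) f v = compose (Arc D) g v"
  obtain a b where ab: "a \<in> Arc D" "b \<in> Arc D" "v a \<noteq> v b"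
    using nonconstant_two_values[OF v assms] .
  show "f = g"
  proof (rule rigid)
    show "f (v a) = g (v a)" "f (v b) = g (v b)"
      using ab fun_cong[OF eq, of a] fun_cong[OF eq, of b] by (auto simp: compose_def)
  qed (use ab fg v Col_mem[of v D] in \<open>auto simp: Aut_def\<close>)
qed (use that in blast)

lemma finite_Col:
  assumes "finite (Arc D)"
  shows "finite (Col X D)"
proof (rule finite_subset)
  show "Col X D \<subseteq> Arc D \<rightarrow>\<^sub>E Q"
    by (auto simp: Col_def)
qed (intro finite_PiE finite_carrier assms)

lemma card_Const: "Arc D \<noteq> {} \<Longrightarrow> card (Const D) = card Q"
  unfolding Const_def by (intro card_image inj_const)

lemma Const_subset: "Const D \<subseteq> Col X D"
  by (auto simp: Const_def const_Col)

text \<open>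
  The number of orbits of nonconstant colorings depends only on the number of colorings.
\<close>

lemma card_transversal:
  assumes "Arc D \<noteq> {}" "finite (Arc D)"
    and "bij_betw (\<lambda>(f, t). compose (Arc D) f t) (Aut \<times> T) (Col X D - Const D)"
  shows "card Aut * card T = card (Col X D) - card Q"
  using bij_betw_same_card[OF assms(3)] assms(1,2)
  by (simp add: card_cartesian_product card_Diff_subset finite_subset[OF Const_subset finite_Col]
      Const_subset card_Const)

text \<open>
  Every nonconstant coloring is \<open>f \<circ> t\<close> for exactly one automorphism \<open>f\<close> and one representative
  \<open>t\<close> of an orbit; it is sent to \<open>f \<circ> \<tau> t\<close>, where \<open>\<tau>\<close> is a bijection of the representatives. This
  commutes with automorphisms since \<open>g \<circ> (f \<circ> t) = (g \<circ> f) \<circ> t\<close>. It commutes with constant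
  endomorphisms since they turn any coloring into the constant coloring of a fixed value.
\<close>

lemma equivariant_bijection_Arc_nonempty:
  assumes ne: "Arc D \<noteq> {}" "Arc D' \<noteq> {}" and fin: "finite (Arc D)" "finite (Arc D')"
    and card: "card (Col X D) = card (Col X D')"
  obtains \<phi> where "bij_betw \<phi> (Col X D) (Col X D')"
    "\<And>f v. f \<in> quandle_End X \<Longrightarrow> v \<in> Col X D \<Longrightarrow>
       \<phi> (compose (Arc D) f v) = compose (Arc D') f (\<phi> v)"
proof -
  let ?m = "\<lambda>D (f, t). compose (Arc D) f t"
  obtain T where T: "T \<subseteq> Col X D - Const D"
    "bij_betw (?m D) (Aut \<times> T) (Col X D - Const D)"
    using nonconstant_transversal[OF ne(1)] .
  obtain T' where T': "T' \<subseteq> Col X D' - Const D'"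
    "bij_betw (?m D') (Aut \<times> T') (Col X D' - Const D')"
    using nonconstant_transversal[OF ne(2)] .
  have "card Aut * card T = card Aut * card T'"
    using card_transversal[OF ne(1) fin(1) T(2)] card_transversal[OF ne(2) fin(2) T'(2)] card
    by simp
  moreover have "card Aut > 0"
    using id_Aut finite_Aut by (auto simp: card_gt_0_iff)
  ultimately have "card T = card T'"
    by simp
  moreover have "finite T" "finite T'"
    using T(1) T'(1) finite_Col[OF fin(1)] finite_Col[OF fin(2)] by (meson finite_Diff finite_subset)+
  ultimately obtain \<tau> where \<tau>: "bij_betw \<tau> T T'"
    using finite_same_card_bij by blast
  obtain a where a: "a \<in> Arc D"
    using ne by blast
  \<comment> \<open>The value at any one arc \<open>a\<close> recovers the constant.\<close>
  define \<phi> where "\<phi> v = (if v \<in> Const D then (\<lambda>b\<in>Arc D'. v a)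
      else ?m D' (map_prod id \<tau> (inv_into (Aut \<times> T) (?m D) v)))" for v
  have \<phi>_const: "\<phi> (\<lambda>b\<in>Arc D. c) = (\<lambda>b\<in>Arc D'. c)" if "c \<in> Q" for c
    using that a by (simp add: \<phi>_def Const_def)
  have \<phi>_orbit: "\<phi> (compose (Arc D) f t) = compose (Arc D') f (\<tau> t)" if "f \<in> Aut" "t \<in> T" for f t
  proof -
    have "inv_into (Aut \<times> T) (?m D) (?m D (f, t)) = (f, t)"
      using that by (intro bij_betw_inv_into_left[OF T(2)]) auto
    moreover have "compose (Arc D) f t \<notin> Const D"
      using compose_nonconstant[of t D f] that T(1) by blast
    ultimately show ?thesis
      by (simp add: \<phi>_def)
  qed
  have "bij_betw \<phi> (Const D) (Const D')"
  proof -
    have "bij_betw (\<lambda>c. \<lambda>b\<in>Arc D. c) Q (Const D)" "bij_betw (\<lambda>c. \<lambda>b\<in>Arc D'. c) Q (Const D')"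
      using inj_const ne by (auto simp: Const_def bij_betw_def)
    moreover have "bij_betw (\<phi> \<circ> (\<lambda>c. \<lambda>b\<in>Arc D. c)) Q (Const D') \<longleftrightarrow>
        bij_betw (\<lambda>c. \<lambda>b\<in>Arc D'. c) Q (Const D')"
      by (intro bij_betw_cong) (simp add: \<phi>_const)
    ultimately show ?thesis
      using bij_betw_comp_iff by blast
  qed
  moreover have "bij_betw \<phi> (Col X D - Const D) (Col X D' - Const D')"
  proof -
    have "bij_betw (?m D' \<circ> map_prod id \<tau>) (Aut \<times> T) (Col X D' - Const D')"
      using T'(2) \<tau> by (intro bij_betw_trans[OF bij_betw_map_prod]) auto
    moreover have "bij_betw (\<phi> \<circ> ?m D) (Aut \<times> T) (Col X D' - Const D') \<longleftrightarrow>
        bij_betw (?m D' \<circ> map_prod id \<tau>) (Aut \<times> T) (Col X D' - Const D')"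
      by (intro bij_betw_cong) (auto simp: \<phi>_orbit)
    ultimately show ?thesis
      using bij_betw_comp_iff[OF T(2)] by blast
  qed
  ultimately have bij: "bij_betw \<phi> (Const D \<union> (Col X D - Const D)) (Const D' \<union> (Col X D' - Const D'))"
    by (rule bij_betw_combine) auto
  then have bij: "bij_betw \<phi> (Col X D) (Col X D')"
    using Const_subset by (metis Un_Diff_cancel sup.absorb2)
  have "\<phi> (compose (Arc D) f v) = compose (Arc D') f (\<phi> v)"
    if f: "f \<in> quandle_End X" and v: "v \<in> Col X D" for f v
    using f
  proof (cases rule: End_cases)
    case (2 c)
    moreover have "\<phi> v \<in> Col X D'"
      using bij v by (auto simp: bij_betw_def)
    ultimately show ?thesis
      using v by (simp add: compose_const_Col \<phi>_const)
  next
    case f_Aut: 1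
    show ?thesis
    proof (cases "v \<in> Const D")
      case True
      then obtain c where "c \<in> Q" "v = (\<lambda>b\<in>Arc D. c)"
        by (auto simp: Const_def)
      then show ?thesis
        by (simp add: compose_Const \<phi>_const End_mem[OF f])
    next
      case False
      then obtain g t where gt: "g \<in> Aut" "t \<in> T" "v = compose (Arc D) g t"
        using v bij_betw_imp_surj_on[OF T(2)] by force
      have t: "t \<in> Col X D" "\<tau> t \<in> Col X D'"
        using gt T(1) T'(1) \<tau> by (auto simp: bij_betw_def)
      then show ?thesis
        using gt f_Aut by (simp add: compose_assoc_Col \<phi>_orbit compose_Aut)
    qed
  qed
  with bij that show thesis
    by blast
qed

lemma Col_Arc_empty: "Arc D = {} \<Longrightarrow> Col X D = {\<lambda>_. undefined}"
  by (auto simp: Col_def dest!: crossing_arcs_in_Arc)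

lemma card_Col_ge_2:
  assumes "Arc D \<noteq> {}" "finite (Arc D)"
  shows "card (Col X D) \<ge> 2"
  using card_mono[OF finite_Col[OF assms(2)] Const_subset] nontrivial
  by (simp add: card_Const assms(1))

text \<open>
  A diagram without arcs has a single coloring, so equality of the numbers of colorings forces the
  other diagram to have no arcs either; both sets of colorings then consist of the same function.
\<close>

lemma equivariant_bijection:
  assumes fin: "finite (Arc D)" "finite (Arc D')"
    and card: "card (Col X D) = card (Col X D')"
  obtains \<phi> where "bij_betw \<phi> (Col X D) (Col X D')"
    "\<And>f v. f \<in> quandle_End X \<Longrightarrow> v \<in> Col X D \<Longrightarrow>
       \<phi> (compose (Arc D) f v) = compose (Arc D') f (\<phi> v)"
proof (cases "Arc D = {} \<or> Arc D' = {}")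
  case True
  then have "card (Col X D) = 1"
    using card by (auto simp: Col_Arc_empty)
  then have e: "Arc D = {}" "Arc D' = {}"
    using card card_Col_ge_2[of D] card_Col_ge_2[of D'] fin by fastforce+
  show thesis
    by (rule that[of id]) (simp_all add: e Col_Arc_empty bij_betw_def compose_def restrict_def)
next
  case False
  then show thesis
    using equivariant_bijection_Arc_nonempty[OF _ _ fin card] that by blast
qed

text \<open>
  An equivariant map carries the edge from \<open>v\<close> to \<open>f \<circ> v\<close> to an edge given by the same \<open>f\<close>; its
  injectivity ensures that no further edges arise.
\<close>

theorem quiver_isomorphic_iff_card_Col_eq:
  assumes fin: "finite (Arc D)" "finite (Arc D')" and S: "S \<subseteq> quandle_End X"
  shows "quiver_isomorphic (coloring_quiver X S D) (coloring_quiver X S D') \<longleftrightarrow>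
         card (Col X D) = card (Col X D')"
proof
  assume "quiver_isomorphic (coloring_quiver X S D) (coloring_quiver X S D')"
  then show "card (Col X D) = card (Col X D')"
    by (auto simp: quiver_isomorphic_def coloring_quiver_def intro: bij_betw_same_card)
next
  assume "card (Col X D) = card (Col X D')"
  then obtain \<phi> where \<phi>: "bij_betw \<phi> (Col X D) (Col X D')"
    and equi: "\<And>f v. f \<in> quandle_End X \<Longrightarrow> v \<in> Col X D \<Longrightarrow>
       \<phi> (compose (Arc D) f v) = compose (Arc D') f (\<phi> v)"
    using equivariant_bijection[OF fin] by blast
  have "w = compose (Arc D) f v \<longleftrightarrow> \<phi> w = compose (Arc D') f (\<phi> v)"
    if "v \<in> Col X D" "w \<in> Col X D" "f \<in> S" for v w f
  proof -
    have f: "f \<in> quandle_End X"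
      using that S by blast
    show ?thesis
      unfolding equi[OF f that(1), symmetric]
      using inj_on_eq_iff[OF bij_betw_imp_inj_on[OF \<phi>]] that compose_Col[OF f] by blast
  qed
  moreover have "\<phi> v \<in> Col X D'" if "v \<in> Col X D" for v
    using that \<phi> by (auto simp: bij_betw_def)
  ultimately show "quiver_isomorphic (coloring_quiver X S D) (coloring_quiver X S D')"
    using \<phi> unfolding quiver_isomorphic_def coloring_quiver_def
    by (intro exI[of _ \<phi>]) auto
qed

end

section \<open>Dihedral quandles of prime order\<close>

text \<open>
  The step \<open>y - x\<close> is invertible modulo the prime \<open>p\<close>, as distinct residues do not differ by a
  multiple of \<open>p\<close>.
\<close>

lemma residue_on_progression:
  fixes x y z :: int
  assumes "prime p" "x \<in> {0..<int p}" "y \<in> {0..<int p}" "x \<noteq> y" "z \<in> {0..<int p}"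
  obtains k :: nat where "z = (x + int k * (y - x)) mod int p"
proof -
  have "\<not> int p dvd y - x"
    using assms zdvd_imp_le[of "int p" "\<bar>y - x\<bar>"] by auto
  then have "coprime (y - x) (int p)"
    using assms(1) by (metis coprime_commute prime_imp_coprime prime_nat_int_transfer)
  then obtain m where m: "[(y - x) * m = 1] (mod int p)"
    using cong_solve_coprime_int by blast
  have p: "int p > 0"
    using assms by auto
  define k where "k = nat ((m * (z - x)) mod int p)"
  have "[int k = m * (z - x)] (mod int p)"
    using p by (simp add: k_def)
  then have "[x + int k * (y - x) = x + m * (z - x) * (y - x)] (mod int p)"
    by (intro cong_add cong_mult cong_refl)
  also have "x + m * (z - x) * (y - x) = x + ((y - x) * m) * (z - x)"
    by (simp add: algebra_simps)
  also have "[\<dots> = x + 1 * (z - x)] (mod int p)"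
    by (intro cong_add cong_mult cong_refl m)
  finally show thesis
    using assms that[of k] by (simp add: cong_def)
qed

text \<open>
  Consecutive terms of the progression \<open>x + k (y - x)\<close> satisfy \<open>z\<^sub>k\<^sub>+\<^sub>2 = 2 z\<^sub>k\<^sub>+\<^sub>1 - z\<^sub>k\<close>, which is the
  quandle product of \<open>z\<^sub>k\<close> and \<open>z\<^sub>k\<^sub>+\<^sub>1\<close>. So agreement at \<open>x\<close> and \<open>y\<close> propagates along the progression,
  which runs through all residues.
\<close>

lemma dihedral_End_rigid:
  assumes p: "prime p" and f: "f \<in> quandle_End (dihedral_quandle p)"
    and g: "g \<in> quandle_End (dihedral_quandle p)"
    and xy: "x \<in> {0..<int p}" "y \<in> {0..<int p}" "x \<noteq> y" "f x = g x" "f y = g y"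
  shows "f = g"
proof
  let ?z = "\<lambda>k::nat. (x + int k * (y - x)) mod int p"
  have p0: "int p > 0"
    using xy by auto
  have hom: "h ((2 * b - a) mod int p) = (2 * h b - h a) mod int p"
    if "h \<in> quandle_End (dihedral_quandle p)" "a \<in> {0..<int p}" "b \<in> {0..<int p}" for h a b
    using that by (simp add: quandle_End_def dihedral_quandle_def)
  have step: "?z (Suc (Suc k)) = (2 * ?z (Suc k) - ?z k) mod int p" for k
  proof -
    have "(2 * ?z (Suc k) - ?z k) mod int p =
        (2 * (x + int (Suc k) * (y - x)) - (x + int k * (y - x))) mod int p"
      by (rule mod_diff_cong) (rule mod_mult_right_eq, rule mod_mod_trivial)
    then show ?thesis
      by (simp add: algebra_simps)
  qed
  have agree: "f (?z k) = g (?z k)" for k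
  proof (induction k rule: induct_nat_012)
    case (ge2 k)
    have "?z k \<in> {0..<int p}" "?z (Suc k) \<in> {0..<int p}"
      using p0 by auto
    then show ?case
      unfolding step by (simp only: hom f g ge2)
  qed (use xy in auto)
  fix z
  show "f z = g z"
  proof (cases "z \<in> {0..<int p}")
    case True
    then show ?thesis
      using residue_on_progression[OF p xy(1-3)] agree by metis
  next
    case False
    then show ?thesis
      using f g by (simp add: quandle_End_def dihedral_quandle_def PiE_def extensional_def)
  qed
qed

lemma rigid_dihedral_quandle:
  assumes "prime p"
  shows "rigid_quandle (dihedral_quandle p)"
proof
  show "quandle (dihedral_quandle p)"
    using assms by (intro quandle_dihedral_quandle prime_gt_0_nat)
  show "card (qcarrier (dihedral_quandle p)) \<ge> 2"
    using prime_ge_2_nat[OF assms] by (simp add: dihedral_quandle_def)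
qed (use dihedral_End_rigid[OF assms] in \<open>auto simp: dihedral_quandle_def\<close>)

theorem theorem3p3:
  fixes D D' :: link_diagram and p :: nat and S :: "(int \<Rightarrow> int) set"
  assumes "is_link_diagram D" and "is_link_diagram D'"
    and "prime p"
    and "S \<subseteq> quandle_End (dihedral_quandle p)"
  shows "quiver_isomorphic (coloring_quiver (dihedral_quandle p) S D)
           (coloring_quiver (dihedral_quandle p) S D') \<longleftrightarrow>
         card (Col (dihedral_quandle p) D) = card (Col (dihedral_quandle p) D')"
proof -
  have "finite (Arc L)" if "is_link_diagram L" for L
    using that unfolding is_link_diagram_def by (intro finite_Arc) (meson finite_subset)
  then have "finite (Arc D)" "finite (Arc D')"
    using assms(1,2) by blast+
  then show ?thesis
    using rigid_quandle.quiver_isomorphic_iff_card_Col_eq[OF rigid_dihedral_quandle] assms(3,4)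
    by blast
qed

end
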